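(* Let $k\in\mathcal{C}$ be a circle with center $c\in\mathcal{P}$ and let $\mathcal{K}=\{c\}$ (the one-letter word $c$). There exists a countable set $Y=\{p_1,p_2,\dots\}\subset k$ that is dense in $k$ and such that in every straightedge deterministic (not necessarily terminating) $\mathrm{EC}_{\infty}(\emptyset)$ $T=(r,V,E)$ with root $r=kp_1p_2\dots$, for every vertex $u\in V$ the point $c$ is not a letter of $u$. Thus no straightedge deterministic $\mathrm{EC}_{\infty}(\emptyset)$ constructs $\mathcal{K}$ (the center $c$ of $k$) from $r$ (the given circle $k$ plus the infinitely many points $Y$ on it).
   Context: A rooted tree $T=(r,V,E)$ consists of a vertex set $V$, a root $r\in V$ and edges $E\subset V\times V$ such that for every $u\in V$ there is a unique walk from $r$ to $u$; if $(u,v)\in E$ then $v$ is a child of $u$; a leaf is a vertex with no child; a branch is a maximal (finite or infinite) walk. $\mathcal{P}=\mathbb{R}^2$ is the set of points, $\mathcal{L}$ the set of lines in $\mathbb{R}^2$, $\mathcal{C}$ the set of circles of positive radius in $\mathbb{R}^2$; elements of $\mathcal{L}\cup\mathcal{C}$ are called curves. For points $a\ne b$, $l(a,b)$ is the line through $a,b$. For points $a$ and $b\neq c$, $k(a,b,c)$ is the circle with center $a$ and radius $|bc|$; moreover $k(a,b,b)=a\in\mathcal{P}$. A set $Y\subset k$ is dense in the circle $k$ if $Y\cap D\ne\emptyset$ for every open disc $D$ of positive radius intersecting $k$. A deterministic Euclidean construction with infinite configurations, denoted $\mathrm{EC}_\infty(\emptyset)$, is a rooted tree $T=(r,V,E)$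 whose root is an infinite word $r=a_0a_1\dots$ of length $\omega$ and whose other vertices are words $a_0a_1\dots;a_\omega a_{\omega+1}\dots a_{\omega+i}$ with $i\in\{0,1,2,\dots\}$ (indexed by the ordinal $\omega+i+1$), all letters being in $\mathcal{P}\cup\mathcal{L}\cup\mathcal{C}$. Each vertex $u$ either is a leaf or has exactly one child $v$, which is $u$ with one letter $a$ appended at the end (at index $\omega$ if $u=r$, at index $\omega+i+1$ if the last index in $u$ is $\omega+i$), where $a$ is one of the following: (line rule) $a=l(p,q)$ for two distinct points $p,q$ that are letters of $u$; (circle rule) $a=k(p,q,s)$ for some (not necessarily distinct) points $p,q,s$ that are letters of $u$; (intersection rule) $a\in\mathcal{P}$ is an intersection point of two distinct curves that are letters of $u$. $T$ is a straightedge construction if the circle rule is never used with $q\ne s$. $T$ is terminating if all its branches are finite. For a set $\mathcal{K}$ of finite words over $\mathcal{P}\cup\mathcal{L}\cup\mathcal{C}$, an $\mathrm{EC}_\infty(\emptyset)$ of a certain type constructs $\mathcal{K}$ from $r$ if there is a terminating $\mathrm{EC}_\infty(\emptyset)$ $T=(r,V,E)$ of that type with root $r$ such that every leaf of $T$ has a final segment belonging to $\mathcal{K}$. *)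

theory Defs
  imports "HOL-Analysis.Analysis" "HOL-Library.Sublist"
begin

section \<open>Rooted trees\<close>

text \<open>Walks are nonempty sequences of vertices, finite or of order type omega.\<close>

datatype 'v walk = Fin_Walk "'v list" | Inf_Walk "nat \<Rightarrow> 'v"

definition finite_walk :: "'v set \<Rightarrow> ('v \<times> 'v) set \<Rightarrow> 'v list \<Rightarrow> bool" where
  "finite_walk V E us \<longleftrightarrow> us \<noteq> [] \<and> set us \<subseteq> V \<and>
     (\<forall>i. Suc i < length us \<longrightarrow> (us ! i, us ! Suc i) \<in> E)"

definition infinite_walk :: "'v set \<Rightarrow> ('v \<times> 'v) set \<Rightarrow> (nat \<Rightarrow> 'v) \<Rightarrow> bool" where
  "infinite_walk V E f \<longleftrightarrow> range f \<subseteq> V \<and> (\<forall>i. (f i, f (Suc i)) \<in> E)"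

fun is_walk :: "'v set \<Rightarrow> ('v \<times> 'v) set \<Rightarrow> 'v walk \<Rightarrow> bool" where
  "is_walk V E (Fin_Walk us) = finite_walk V E us"
| "is_walk V E (Inf_Walk f) = infinite_walk V E f"

text \<open>The first walk is a contiguous segment of the second.\<close>

fun subwalk :: "'v walk \<Rightarrow> 'v walk \<Rightarrow> bool" where
  "subwalk (Fin_Walk us) (Fin_Walk vs) = sublist us vs"
| "subwalk (Fin_Walk us) (Inf_Walk g) = (\<exists>n. \<forall>i<length us. us ! i = g (n + i))"
| "subwalk (Inf_Walk f) (Fin_Walk vs) = False"
| "subwalk (Inf_Walk f) (Inf_Walk g) = (\<exists>n. \<forall>i. f i = g (n + i))"

definition branch :: "'v set \<Rightarrow> ('v \<times> 'v) set \<Rightarrow> 'v walk \<Rightarrow> bool" where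
  "branch V E b \<longleftrightarrow> is_walk V E b \<and> (\<forall>b'. is_walk V E b' \<and> subwalk b b' \<longrightarrow> b' = b)"

definition rooted_tree :: "'v \<Rightarrow> 'v set \<Rightarrow> ('v \<times> 'v) set \<Rightarrow> bool" where
  "rooted_tree r V E \<longleftrightarrow> r \<in> V \<and> E \<subseteq> V \<times> V \<and>
     (\<forall>u\<in>V. \<exists>!us. finite_walk V E us \<and> hd us = r \<and> last us = u)"

definition children :: "('v \<times> 'v) set \<Rightarrow> 'v \<Rightarrow> 'v set" where
  "children E u = {v. (u, v) \<in> E}"

definition leaf :: "'v set \<Rightarrow> ('v \<times> 'v) set \<Rightarrow> 'v \<Rightarrow> bool" where
  "leaf V E u \<longleftrightarrow> u \<in> V \<and> children E u = {}"

definition terminating :: "'v set \<Rightarrow> ('v \<times> 'v) set \<Rightarrow> bool" where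
  "terminating V E \<longleftrightarrow> (\<forall>b. branch V E b \<longrightarrow> (\<exists>us. b = Fin_Walk us))"

section \<open>Points, lines and circles\<close>

type_synonym point = "real^2"

definition line_through :: "point \<Rightarrow> point \<Rightarrow> point set" where
  "line_through a b = affine hull {a, b}"

definition plane_lines :: "point set set" where
  "plane_lines = {line_through a b | a b. a \<noteq> b}"

definition plane_circles :: "point set set" where
  "plane_circles = {sphere a \<rho> | a \<rho>. \<rho> > 0}"

definition dense_in_circle :: "point set \<Rightarrow> point set \<Rightarrow> bool" where
  "dense_in_circle Y k \<longleftrightarrow> Y \<subseteq> k \<and>
     (\<forall>x \<rho>. \<rho> > 0 \<and> ball x \<rho> \<inter> k \<noteq> {} \<longrightarrow> Y \<inter> ball x \<rho> \<noteq> {})"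

section \<open>Letters and words\<close>

text \<open>A curve is represented by its set of points; only members of \<open>alphabet\<close> are
  legitimate letters.\<close>

datatype letter = Point point | Curve "point set"

definition alphabet :: "letter set" where
  "alphabet = range Point \<union> Curve ` (plane_lines \<union> plane_circles)"

text \<open>\<open>(w, [x\<^sub>0, \<dots>, x\<^sub>i])\<close> is the word \<open>w 0, w 1, \<dots>; x\<^sub>0, \<dots>, x\<^sub>i\<close> indexed by the ordinal
  \<open>\<omega> + i + 1\<close>; \<open>(w, [])\<close> is the word \<open>w\<close> of length \<open>\<omega>\<close>.\<close>

type_synonym config = "(nat \<Rightarrow> letter) \<times> letter list"

definition letters :: "config \<Rightarrow> letter set" where
  "letters u = range (fst u) \<union> set (snd u)"

definition append_letter :: "config \<Rightarrow> letter \<Rightarrow> config" where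
  "append_letter u a = (fst u, snd u @ [a])"

text \<open>A finite final segment of a word of length at least \<open>\<omega>\<close> cannot reach into the
  first \<open>\<omega>\<close> letters.\<close>

definition final_segment :: "letter list \<Rightarrow> config \<Rightarrow> bool" where
  "final_segment s u \<longleftrightarrow> suffix s (snd u)"

section \<open>Deterministic Euclidean constructions with infinite configurations\<close>

definition compass :: "point \<Rightarrow> point \<Rightarrow> point \<Rightarrow> letter" where
  "compass a b c = (if b = c then Point a else Curve (sphere a (dist b c)))"

definition line_rule :: "config \<Rightarrow> letter \<Rightarrow> bool" where
  "line_rule u a \<longleftrightarrow> (\<exists>p q. Point p \<in> letters u \<and> Point q \<in> letters u \<and> p \<noteq> q \<and>
     a = Curve (line_through p q))"

definition circle_rule :: "config \<Rightarrow> letter \<Rightarrow> bool" where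
  "circle_rule u a \<longleftrightarrow> (\<exists>p q s. Point p \<in> letters u \<and> Point q \<in> letters u \<and>
     Point s \<in> letters u \<and> a = compass p q s)"

definition intersection_rule :: "config \<Rightarrow> letter \<Rightarrow> bool" where
  "intersection_rule u a \<longleftrightarrow> (\<exists>x C D. Curve C \<in> letters u \<and> Curve D \<in> letters u \<and> C \<noteq> D \<and>
     x \<in> C \<inter> D \<and> a = Point x)"

definition EC_inf :: "config \<Rightarrow> config set \<Rightarrow> (config \<times> config) set \<Rightarrow> bool" where
  "EC_inf r V E \<longleftrightarrow> rooted_tree r V E \<and>
     snd r = [] \<and> (\<forall>u\<in>V. u \<noteq> r \<longrightarrow> snd u \<noteq> []) \<and>
     (\<forall>u\<in>V. letters u \<subseteq> alphabet) \<and>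
     (\<forall>u\<in>V. leaf V E u \<or>
        (\<exists>a. children E u = {append_letter u a} \<and>
           (line_rule u a \<or> circle_rule u a \<or> intersection_rule u a)))"

definition straightedge :: "config \<Rightarrow> config set \<Rightarrow> (config \<times> config) set \<Rightarrow> bool" where
  "straightedge r V E \<longleftrightarrow>
     \<not> (\<exists>u p q s. Point p \<in> letters u \<and> Point q \<in> letters u \<and> Point s \<in> letters u \<and> q \<noteq> s \<and>
          (u, append_letter u (compass p q s)) \<in> E)"

text \<open>The type of construction is a property \<open>ty\<close> of the tree \<open>(r, V, E)\<close>.\<close>

definition constructs ::
  "(config \<Rightarrow> config set \<Rightarrow> (config \<times> config) set \<Rightarrow> bool) \<Rightarrow> letter list set \<Rightarrow> config \<Rightarrow> bool"
  where
  "constructs ty K r \<longleftrightarrow> (\<exists>V E. EC_inf r V E \<and> ty r V E \<and> terminating V E \<and>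
     (\<forall>u. leaf V E u \<longrightarrow> (\<exists>s\<in>K. final_segment s u)))"

text \<open>The infinite word \<open>k p\<^sub>1 p\<^sub>2 \<dots>\<close>, where \<open>p\<^sub>i\<close> is \<open>p (i - 1)\<close>.\<close>

definition circle_points_word :: "point set \<Rightarrow> (nat \<Rightarrow> point) \<Rightarrow> config" where
  "circle_points_word k p = (case_nat (Curve k) (\<lambda>i. Point (p i)), [])"

end

theory Submission
  imports Defs
begin

text \<open>
  A projective map preserving a circle turns straightedge constructions into straightedge
  constructions, but it may move the center. Let \<open>F\<close> be a countable subfield of the reals closed
  under square roots. From points of the circle with projective coordinates in \<open>F\<close> a straightedge
  only produces points with projective coordinates in \<open>F\<close>, in whatever projective frame the
  coordinates are taken. Since \<open>F\<close> is countable, there is \<open>v \<in> (0, 1) - F\<close>; in the frame obtained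
  by the Lorentz boost of velocity \<open>v\<close>, which preserves the circle, the center has coordinates
  \<open>(-v : 0 : 1)\<close> and so cannot be reached.
\<close>

section \<open>A countable field closed under square roots\<close>

text \<open>Division and root carry no side conditions: in HOL \<open>a / 0 = 0\<close> and
  \<open>sqrt (- a) = - sqrt a\<close>, so the totalized operations stay in any field closed under
  roots of its nonnegative elements.\<close>

locale sqrt_closed_field =
  fixes F :: "real set"
  assumes one_mem: "1 \<in> F"
    and diff_mem: "a \<in> F \<Longrightarrow> b \<in> F \<Longrightarrow> a - b \<in> F"
    and mult_mem: "a \<in> F \<Longrightarrow> b \<in> F \<Longrightarrow> a * b \<in> F"
    and divide_mem: "a \<in> F \<Longrightarrow> b \<in> F \<Longrightarrow> a / b \<in> F"
    and sqrt_mem: "a \<in> F \<Longrightarrow> sqrt a \<in> F"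
begin

lemma zero_mem: "0 \<in> F"
  using diff_mem[OF one_mem one_mem] by simp

lemma uminus_mem: "a \<in> F \<Longrightarrow> - a \<in> F"
  using diff_mem[OF zero_mem, of a] by simp

lemma add_mem: "a \<in> F \<Longrightarrow> b \<in> F \<Longrightarrow> a + b \<in> F"
  using diff_mem[OF _ uminus_mem, of a b] by simp

lemma power2_mem: "a \<in> F \<Longrightarrow> a\<^sup>2 \<in> F"
  by (simp add: power2_eq_square mult_mem)

lemma of_nat_mem: "real n \<in> F"
  by (induction n) (auto simp: zero_mem one_mem add_mem)

lemma Rats_subset: "\<rat> \<subseteq> F"
proof
  fix x :: real assume "x \<in> \<rat>"
  then obtain m n where "\<bar>x\<bar> = real m / real n"
    using Rats_abs_nat_div_natE by metis
  then have "\<bar>x\<bar> \<in> F" by (simp add: divide_mem of_nat_mem)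
  then show "x \<in> F" using uminus_mem[of "\<bar>x\<bar>"] by (cases "x \<ge> 0") auto
qed

lemma mem_if_power2_mem:
  assumes "t\<^sup>2 \<in> F"
  shows "t \<in> F"
proof -
  have "\<bar>t\<bar> \<in> F" using sqrt_mem[OF assms] by simp
  then show ?thesis using uminus_mem[of "\<bar>t\<bar>"] by (cases "t \<ge> 0") auto
qed

text \<open>With \<open>t = m * a - l * b\<close>, the two-squares identity turns the circle
  equation into t^2 = l^2 + m^2 - n^2, so one square root yields \<open>t\<close>. Then
  \<open>a\<close> and \<open>b\<close> solve a linear system over \<open>F\<close> whose
  determinant is, up to sign, l^2 + m^2.\<close>

lemma unit_circle_line_mem:
  assumes "l \<in> F" "m \<in> F" "n \<in> F" and nz: "l \<noteq> 0 \<or> m \<noteq> 0"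
    and line: "l * a + m * b + n = 0" and circle: "a\<^sup>2 + b\<^sup>2 = 1"
  shows "a \<in> F" "b \<in> F"
proof -
  define t where "t = m * a - l * b"
  have n: "n = - (l * a + m * b)" using line by simp
  have "t\<^sup>2 + n\<^sup>2 = (l\<^sup>2 + m\<^sup>2) * (a\<^sup>2 + b\<^sup>2)"
    unfolding t_def n by (simp add: power2_eq_square algebra_simps)
  then have "t\<^sup>2 = l\<^sup>2 + m\<^sup>2 - n\<^sup>2" using circle by simp
  then have t: "t \<in> F"
    using assms(1-3) by - (rule mem_if_power2_mem, simp add: add_mem diff_mem power2_mem)
  have pos: "l\<^sup>2 + m\<^sup>2 \<noteq> 0" using nz by (simp add: sum_power2_eq_zero_iff)
  have "a * (l\<^sup>2 + m\<^sup>2) = m * t - l * n" "b * (l\<^sup>2 + m\<^sup>2) = - (m * n) - l * t"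
    unfolding t_def n by (simp_all add: power2_eq_square algebra_simps)
  then have "a = (m * t - l * n) / (l\<^sup>2 + m\<^sup>2)" "b = (- (m * n) - l * t) / (l\<^sup>2 + m\<^sup>2)"
    using pos by (simp_all add: eq_divide_eq)
  then show "a \<in> F" "b \<in> F"
    using assms(1-3) t by (simp_all add: add_mem diff_mem mult_mem uminus_mem divide_mem power2_mem)
qed

end

text \<open>Finite terms built from the constant one: there are countably many, and the set of their
  values is closed under the required operations by construction.\<close>

datatype sqrt_expr = One | Minus sqrt_expr sqrt_expr | Times sqrt_expr sqrt_expr
  | Divide sqrt_expr sqrt_expr | Sqrt sqrt_expr

instance sqrt_expr :: countable
  by countable_datatype

primrec sqrt_expr_value :: "sqrt_expr \<Rightarrow> real" where
  "sqrt_expr_value One = 1"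
| "sqrt_expr_value (Minus a b) = sqrt_expr_value a - sqrt_expr_value b"
| "sqrt_expr_value (Times a b) = sqrt_expr_value a * sqrt_expr_value b"
| "sqrt_expr_value (Divide a b) = sqrt_expr_value a / sqrt_expr_value b"
| "sqrt_expr_value (Sqrt a) = sqrt (sqrt_expr_value a)"

lemma countable_sqrt_closed_field: "\<exists>F. countable F \<and> sqrt_closed_field F"
proof (intro exI conjI)
  show "countable (range sqrt_expr_value)" by simp
  show "sqrt_closed_field (range sqrt_expr_value)"
  proof
    show "1 \<in> range sqrt_expr_value"
      by (metis rangeI sqrt_expr_value.simps(1))
  next
    fix a b assume "a \<in> range sqrt_expr_value" "b \<in> range sqrt_expr_value"
    then obtain s t where "a = sqrt_expr_value s" "b = sqrt_expr_value t" by auto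
    then show "a - b \<in> range sqrt_expr_value" "a * b \<in> range sqrt_expr_value"
      "a / b \<in> range sqrt_expr_value"
      by (metis rangeI sqrt_expr_value.simps(2), metis rangeI sqrt_expr_value.simps(3),
          metis rangeI sqrt_expr_value.simps(4))
  next
    fix a assume "a \<in> range sqrt_expr_value"
    then show "sqrt a \<in> range sqrt_expr_value"
      by (metis rangeE rangeI sqrt_expr_value.simps(5))
  qed
qed

section \<open>Projective coordinates\<close>

text \<open>Puts collinearity into the determinant form that \<open>det_hom\<close>
  produces.\<close>

lemma line_through_eq:
  fixes p q :: point
  assumes "p \<noteq> q"
  shows "line_through p q = {x. (q$1 - p$1) * (x$2 - p$2) = (q$2 - p$2) * (x$1 - p$1)}"
    (is "_ = ?R")
proof
  show "line_through p q \<subseteq> ?R"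
    unfolding line_through_def affine_hull_2_alt by (auto simp: algebra_simps)
  show "?R \<subseteq> line_through p q"
  proof
    fix x assume x: "x \<in> ?R"
    have nz: "q$1 - p$1 \<noteq> 0 \<or> q$2 - p$2 \<noteq> 0"
      using assms by (auto simp: vec_eq_iff forall_2)
    \<comment> \<open>The affine parameter is read off from a coordinate in which \<open>p\<close>
      and \<open>q\<close> differ.\<close>
    define u where "u = (if q$1 - p$1 \<noteq> 0 then (x$1 - p$1) / (q$1 - p$1)
      else (x$2 - p$2) / (q$2 - p$2))"
    have "x$1 - p$1 = u * (q$1 - p$1)" "x$2 - p$2 = u * (q$2 - p$2)"
      using x nz by (auto simp: u_def field_simps)
    then have "x = p + u *\<^sub>R (q - p)"
      by (simp add: vec_eq_iff forall_2 algebra_simps)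
    then show "x \<in> line_through p q"
      unfolding line_through_def affine_hull_2_alt by auto
  qed
qed

context sqrt_closed_field
begin

definition Fvec :: "(real^3) set" where
  "Fvec = {z. \<forall>i. z $ i \<in> F}"

lemma cross3_Fvec: "y \<in> Fvec \<Longrightarrow> z \<in> Fvec \<Longrightarrow> cross3 y z \<in> Fvec"
  unfolding Fvec_def cross3_def by (simp add: forall_3 diff_mem mult_mem)

end

section \<open>The circle in boosted homogeneous coordinates\<close>

locale boosted_circle = sqrt_closed_field +
  fixes c :: point and \<rho> v :: real
  assumes radius_pos: "\<rho> > 0" and velocity: "0 < v" "v < 1"
begin

text \<open>The factor \<open>\<gamma>\<close> turns the circle into \<open>X\<^sup>2 + Y\<^sup>2 = W\<^sup>2\<close> for \<open>hom p = (X, Y, W)\<close>.\<close>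

definition \<gamma> :: real where
  "\<gamma> = sqrt (1 - v\<^sup>2)"

text \<open>The Lorentz boost of velocity \<open>v\<close> applied to the vector
  \<open>(p - c, \<rho>)\<close> with \<open>\<rho>\<close> as time coordinate, scaled by
  \<open>\<gamma>\<close> to clear denominators. Here \<open>\<gamma>\<close> is the reciprocal of
  the usual Lorentz factor.\<close>

definition hom :: "point \<Rightarrow> real^3" where
  "hom p = vector [(p$1 - c$1) - v * \<rho>, \<gamma> * (p$2 - c$2), \<rho> - v * (p$1 - c$1)]"

lemma v_square: "v\<^sup>2 < 1"
  using velocity by (simp add: abs_square_less_1)

lemma \<gamma>_pos: "\<gamma> > 0"
  unfolding \<gamma>_def using v_square by simp

lemma \<gamma>_square: "\<gamma>\<^sup>2 = 1 - v\<^sup>2"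
  unfolding \<gamma>_def using v_square by simp

lemma \<gamma>_mult: "\<gamma> * (\<gamma> * x) = (1 - v\<^sup>2) * x"
  using \<gamma>_square by (metis mult.assoc power2_eq_square)

text \<open>A boost preserves the Minkowski form; the scaling by \<open>\<gamma>\<close> contributes
  the factor 1 - v^2.\<close>

lemma hom_quadratic_form:
  "(hom p $ 1)\<^sup>2 + (hom p $ 2)\<^sup>2 - (hom p $ 3)\<^sup>2
    = (1 - v\<^sup>2) * ((p$1 - c$1)\<^sup>2 + (p$2 - c$2)\<^sup>2 - \<rho>\<^sup>2)"
  unfolding hom_def by (simp add: power_mult_distrib \<gamma>_square) (simp add: power2_eq_square algebra_simps)

lemma mem_sphere_coords: "p \<in> sphere c \<rho> \<longleftrightarrow> (p$1 - c$1)\<^sup>2 + (p$2 - c$2)\<^sup>2 = \<rho>\<^sup>2"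
proof -
  have "dist c p = sqrt ((p$1 - c$1)\<^sup>2 + (p$2 - c$2)\<^sup>2)"
    unfolding dist_vec_def L2_set_def
    by (simp add: UNIV_2 dist_real_def power2_commute)
  then show ?thesis
    using radius_pos by (auto simp: real_sqrt_eq_iff dest: real_sqrt_unique)
qed

lemma mem_sphere_iff: "p \<in> sphere c \<rho> \<longleftrightarrow> (hom p $ 1)\<^sup>2 + (hom p $ 2)\<^sup>2 = (hom p $ 3)\<^sup>2"
  using hom_quadratic_form[of p] v_square unfolding mem_sphere_coords by auto

text \<open>The line where the third coordinate vanishes lies at distance \<open>\<rho> / v\<close>
  from the center, which exceeds the radius, so dividing by that coordinate is safe on the
  circle.\<close>

lemma hom_3_pos:
  assumes "p \<in> sphere c \<rho>"
  shows "hom p $ 3 > 0"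
proof -
  have "(p$1 - c$1)\<^sup>2 \<le> \<rho>\<^sup>2" using assms unfolding mem_sphere_coords
    by (metis le_add_same_cancel1 zero_le_power2)
  then have "p$1 - c$1 \<le> \<rho>" using radius_pos by (simp add: power2_le_iff_abs_le)
  then have "v * (p$1 - c$1) \<le> v * \<rho>" using velocity by simp
  also have "\<dots> < \<rho>" using velocity radius_pos by simp
  finally show ?thesis by (simp add: hom_def)
qed

text \<open>The scaled boost has determinant \<open>\<gamma> * (1 - v\<^sup>2)\<close>; what remains
  is \<open>\<rho>\<close> times twice the signed area of the triangle \<open>p\<close>,
  \<open>q\<close>, \<open>x\<close>.\<close>

lemma det_hom:
  "cross3 (hom p) (hom q) \<bullet> hom x
    = \<gamma> * (1 - v\<^sup>2) * \<rho> * ((q$1 - p$1) * (x$2 - p$2) - (q$2 - p$2) * (x$1 - p$1))"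
  unfolding hom_def cross3_def inner_vec_def
  by (simp add: sum_3) (simp add: power2_eq_square algebra_simps)

lemma det_hom_eq_0_iff:
  "cross3 (hom p) (hom q) \<bullet> hom x = 0
    \<longleftrightarrow> (q$1 - p$1) * (x$2 - p$2) = (q$2 - p$2) * (x$1 - p$1)"
  unfolding det_hom using \<gamma>_pos v_square radius_pos by simp

lemma cross3_hom_nonzero:
  assumes "p \<noteq> q"
  shows "cross3 (hom p) (hom q) \<noteq> 0"
proof
  assume "cross3 (hom p) (hom q) = 0"
  then have *: "(q$1 - p$1) * (x$2 - p$2) = (q$2 - p$2) * (x$1 - p$1)" for x :: point
    using det_hom_eq_0_iff[of p q x] by simp
  \<comment> \<open>One unit step from \<open>p\<close> along each axis isolates one coordinate of
    \<open>q - p\<close>.\<close>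
  from *[of "vector [p$1, p$2 + 1]"] *[of "vector [p$1 + 1, p$2]"]
  show False using assms by (auto simp: vec_eq_iff forall_2)
qed

lemma hom_nonzero: "hom p \<noteq> 0"
proof
  assume "hom p = 0"
  then have "cross3 (hom p) (hom (p + 1)) = 0" by simp
  then show False using cross3_hom_nonzero[of p "p + 1"] by simp
qed

text \<open>Homogeneous coordinates matter only up to scaling, so the real factor
  \<open>\<mu>\<close> is arbitrary and \<open>hom p\<close> itself may have entries outside
  \<open>F\<close>.\<close>

definition F_point :: "point \<Rightarrow> bool" where
  "F_point p \<longleftrightarrow> (\<exists>z\<in>Fvec. \<exists>\<mu>. hom p = \<mu> *\<^sub>R z)"

definition F_line :: "point set \<Rightarrow> bool" where
  "F_line L \<longleftrightarrow> (\<exists>l\<in>Fvec. l \<noteq> 0 \<and> L = {x. l \<bullet> hom x = 0})"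

text \<open>The cross product of the coordinate vectors of two points is a coefficient vector of the
  line joining them.\<close>

lemma F_line_line_through:
  assumes "F_point p" "F_point q" "p \<noteq> q"
  shows "F_line (line_through p q)"
proof -
  obtain y \<mu> where y: "y \<in> Fvec" "hom p = \<mu> *\<^sub>R y" using assms(1) F_point_def by auto
  obtain z \<nu> where z: "z \<in> Fvec" "hom q = \<nu> *\<^sub>R z" using assms(2) F_point_def by auto
  have cross: "cross3 (hom p) (hom q) = (\<mu> * \<nu>) *\<^sub>R cross3 y z"
    by (simp add: y z cross_mult_left cross_mult_right)
  with cross3_hom_nonzero[OF assms(3)] have nz: "\<mu> * \<nu> \<noteq> 0" "cross3 y z \<noteq> 0" by auto
  have "line_through p q = {x. cross3 y z \<bullet> hom x = 0}"
    unfolding line_through_eq[OF assms(3)] det_hom_eq_0_iff[symmetric] cross using nz by simp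
  then show ?thesis
    unfolding F_line_def using nz cross3_Fvec[OF y(1) z(1)] by blast
qed

text \<open>Dual to joining points: the cross product of the coefficient vectors represents the
  intersection point.\<close>

lemma F_point_Int_lines:
  assumes "F_line L" "F_line M" "L \<noteq> M" "x \<in> L" "x \<in> M"
  shows "F_point x"
proof -
  obtain l where l: "l \<in> Fvec" "l \<noteq> 0" "L = {x. l \<bullet> hom x = 0}"
    using assms(1) F_line_def by auto
  obtain m where m: "m \<in> Fvec" "m \<noteq> 0" "M = {x. m \<bullet> hom x = 0}"
    using assms(2) F_line_def by auto
  have "cross3 l m \<noteq> 0"
  proof
    \<comment> \<open>Proportional coefficient vectors would define the same line.\<close>
    assume "cross3 l m = 0"
    then obtain t where t: "m = t *\<^sub>R l"
      using l(2) m(2) by (auto simp: cross_eq_0 collinear_lemma)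
    then have "t \<noteq> 0" using m(2) by auto
    then show False using assms(3) l m t by simp
  qed
  \<comment> \<open>\<open>hom x\<close> is orthogonal to \<open>l\<close> and \<open>m\<close>, so
    the expansion of the triple product vanishes and \<open>hom x\<close> is parallel to
    \<open>cross3 l m\<close>.\<close>
  moreover have "cross3 (cross3 l m) (hom x) = 0"
    using assms(4,5) l m by (simp add: cross_triple Lagrange inner_commute cross_skew[of _ "hom x"])
  ultimately obtain \<mu> where "hom x = \<mu> *\<^sub>R cross3 l m"
    using hom_nonzero[of x] by (auto simp: cross_eq_0 collinear_lemma)
  then show ?thesis
    unfolding F_point_def using cross3_Fvec[OF l(1) m(1)] by blast
qed

lemma F_point_if_ratios:
  assumes "hom p $ 3 \<noteq> 0" "hom p $ 1 / hom p $ 3 \<in> F" "hom p $ 2 / hom p $ 3 \<in> F"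
  shows "F_point p"
proof -
  let ?z = "vector [hom p $ 1 / hom p $ 3, hom p $ 2 / hom p $ 3, 1] :: real^3"
  have "?z \<in> Fvec" using assms by (simp add: Fvec_def forall_3 one_mem)
  moreover have "hom p = (hom p $ 3) *\<^sub>R ?z"
    using assms(1) by (simp add: vec_eq_iff forall_3)
  ultimately show ?thesis unfolding F_point_def by blast
qed

text \<open>Dividing by the third coordinate turns the circle into the unit circle and keeps the
  coefficients of the line in \<open>F\<close>, so \<open>unit_circle_line_mem\<close>
  applies.\<close>

lemma F_point_Int_line_circle:
  assumes "F_line L" "x \<in> L" "x \<in> sphere c \<rho>"
  shows "F_point x"
proof -
  obtain l where l: "l \<in> Fvec" "l \<noteq> 0" "L = {x. l \<bullet> hom x = 0}"
    using assms(1) F_line_def by auto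
  define W where "W = hom x $ 3"
  have W: "W > 0" unfolding W_def using hom_3_pos[OF assms(3)] .
  let ?a = "hom x $ 1 / W" and ?b = "hom x $ 2 / W"
  have "l $ 1 * hom x $ 1 + l $ 2 * hom x $ 2 + l $ 3 * W = 0"
    using assms(2) l(3) by (simp add: inner_vec_def sum_3 W_def)
  then have line: "l $ 1 * ?a + l $ 2 * ?b + l $ 3 = 0"
    using W by (simp add: field_simps)
  have circle: "?a\<^sup>2 + ?b\<^sup>2 = 1"
    using assms(3) W unfolding mem_sphere_iff W_def[symmetric]
    by (simp add: power_divide add_divide_distrib[symmetric])
  have nz: "l $ 1 \<noteq> 0 \<or> l $ 2 \<noteq> 0"
    using line l(2) by (auto simp: vec_eq_iff forall_3)
  have "?a \<in> F" "?b \<in> F"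
    using unit_circle_line_mem[OF _ _ _ nz line circle] l(1) by (auto simp: Fvec_def)
  then show ?thesis using F_point_if_ratios W by (simp add: W_def)
qed

text \<open>The first and third coordinates of \<open>hom c\<close> have ratio \<open>- v\<close>,
  while such ratios lie in \<open>F\<close> for an \<open>F_point\<close>.\<close>

lemma not_F_point_center:
  assumes "v \<notin> F"
  shows "\<not> F_point c"
proof
  assume "F_point c"
  then obtain z \<mu> where z: "z \<in> Fvec" and "hom c = \<mu> *\<^sub>R z"
    by (auto simp: F_point_def)
  then have "hom c $ 1 = \<mu> * z $ 1" "hom c $ 3 = \<mu> * z $ 3" by simp_all
  then have X: "- (v * \<rho>) = \<mu> * z $ 1" and \<rho>: "\<rho> = \<mu> * z $ 3"
    unfolding hom_def by simp_all
  have "\<mu> * (- v * z $ 3) = - (v * (\<mu> * z $ 3))" by simp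
  also have "\<dots> = \<mu> * z $ 1" using X unfolding \<rho>[symmetric] .
  finally have "\<mu> * (- v * z $ 3) = \<mu> * z $ 1" .
  moreover have "\<mu> \<noteq> 0" "z $ 3 \<noteq> 0" using radius_pos \<rho> by auto
  ultimately have "- v * z $ 3 = z $ 1" by (metis mult_left_cancel)
  then have "v = - z $ 1 / z $ 3"
    unfolding nonzero_eq_divide_eq[OF \<open>z $ 3 \<noteq> 0\<close>] by linarith
  then have "v \<in> F" using z by (simp add: Fvec_def divide_mem uminus_mem)
  with assms show False by contradiction
qed

section \<open>Density of the points of the circle with coordinates in the field\<close>

text \<open>Inverts \<open>p \<mapsto> (X / W, Y / W)\<close> where \<open>hom p = (X, Y, W)\<close>.\<close>

definition unhom :: "real \<Rightarrow> real \<Rightarrow> point" where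
  "unhom a b = vector [c$1 + \<rho> * (a + v) / (1 + v * a), c$2 + \<rho> * \<gamma> * b / (1 + v * a)]"

lemma denominator_pos: "\<bar>a\<bar> \<le> 1 \<Longrightarrow> 1 + v * a > 0"
proof -
  assume "\<bar>a\<bar> \<le> 1"
  then have "v * (-1) \<le> v * a" using velocity by (intro mult_left_mono) auto
  then show ?thesis using velocity by simp
qed

text \<open>\<open>unhom\<close> is the boost of velocity \<open>- v\<close> followed by division by
  the last coordinate; the bound on \<open>a\<close> keeps that coordinate positive.\<close>

lemma hom_unhom:
  assumes "\<bar>a\<bar> \<le> 1"
  defines "W \<equiv> \<rho> * (1 - v\<^sup>2) / (1 + v * a)"
  shows "hom (unhom a b) = W *\<^sub>R vector [a, b, 1]" "W > 0"
proof -
  have d: "1 + v * a > 0" using denominator_pos[OF assms(1)] .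
  have "\<rho> * (a + v) / (1 + v * a) - v * \<rho> = W * a"
    "\<rho> - v * (\<rho> * (a + v) / (1 + v * a)) = W"
    using d by (simp_all add: W_def field_simps power2_eq_square)
  moreover have "\<gamma> * (\<rho> * \<gamma> * b / (1 + v * a)) = W * b"
    using \<gamma>_mult[of "\<rho> * b / (1 + v * a)"] by (simp add: W_def mult_ac)
  ultimately show "hom (unhom a b) = W *\<^sub>R vector [a, b, 1]"
    unfolding hom_def unhom_def by (simp add: vec_eq_iff forall_3)
  show "W > 0" using d v_square radius_pos by (simp add: W_def)
qed

lemma unhom_hom:
  assumes "p \<in> sphere c \<rho>"
  shows "unhom (hom p $ 1 / hom p $ 3) (hom p $ 2 / hom p $ 3) = p"
proof -
  define d where "d = p$1 - c$1"
  define W where "W = hom p $ 3"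
  have W: "W > 0" unfolding W_def using hom_3_pos[OF assms] .
  have W_eq: "W = \<rho> - v * d" by (simp add: W_def hom_def d_def)
  have X: "hom p $ 1 = d - v * \<rho>" by (simp add: hom_def d_def)
  have Y: "hom p $ 2 = \<gamma> * (p$2 - c$2)" by (simp add: hom_def)
  have den: "1 + v * ((d - v * \<rho>) / W) = \<rho> * (1 - v\<^sup>2) / W"
    using W by (simp add: field_simps power2_eq_square) (simp add: W_eq algebra_simps)
  have num: "(d - v * \<rho>) / W + v = d * (1 - v\<^sup>2) / W"
    using W by (simp add: field_simps power2_eq_square) (simp add: W_eq algebra_simps)
  have nz: "1 - v\<^sup>2 \<noteq> 0" using v_square by simp
  have "\<rho> * ((d - v * \<rho>) / W + v) / (1 + v * ((d - v * \<rho>) / W)) = d"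
    unfolding den num using W nz radius_pos by simp
  moreover have "\<rho> * \<gamma> * (\<gamma> * (p$2 - c$2) / W) / (1 + v * ((d - v * \<rho>) / W)) = p$2 - c$2"
  proof -
    have "\<rho> * \<gamma> * (\<gamma> * (p$2 - c$2) / W) = \<rho> * (1 - v\<^sup>2) / W * (p$2 - c$2)"
      using \<gamma>_mult[of "\<rho> * (p$2 - c$2) / W"] by (simp add: mult_ac)
    moreover have "\<rho> * (1 - v\<^sup>2) / W \<noteq> 0" using W nz radius_pos by simp
    ultimately show ?thesis unfolding den by (metis nonzero_mult_div_cancel_left)
  qed
  ultimately show ?thesis
    unfolding W_def[symmetric] X Y unhom_def by (simp add: vec_eq_iff forall_2 d_def)
qed

definition F_circle :: "point set" where
  "F_circle = {p \<in> sphere c \<rho>. F_point p}"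

lemma unhom_mem_F_circle:
  assumes "a \<in> F" "\<bar>a\<bar> \<le> 1" "b = sqrt (1 - a\<^sup>2) \<or> b = - sqrt (1 - a\<^sup>2)"
  shows "unhom a b \<in> F_circle"
proof -
  have "sqrt (1 - a\<^sup>2) \<in> F" using assms(1) by (simp add: sqrt_mem diff_mem one_mem power2_mem)
  then have b: "b \<in> F" using assms(3) uminus_mem by auto
  have "b\<^sup>2 = 1 - a\<^sup>2" using assms(2,3) by (auto simp: abs_square_le_1)
  then have circle: "a\<^sup>2 + b\<^sup>2 = 1" by simp
  obtain W where W: "hom (unhom a b) = W *\<^sub>R vector [a, b, 1]" "W > 0"
    using hom_unhom[OF assms(2)] by blast
  have "unhom a b \<in> sphere c \<rho>"
    unfolding mem_sphere_iff W(1) using circle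
    by (simp add: power_mult_distrib distrib_left[symmetric])
  moreover have "F_point (unhom a b)"
    using W assms(1) b by (intro F_point_if_ratios) simp_all
  ultimately show ?thesis by (simp add: F_circle_def)
qed

lemma continuous_on_unhom:
  assumes "continuous_on {-1..1} f"
  shows "continuous_on {-1..1} (\<lambda>a. unhom a (f a))"
proof -
  have d: "1 + v * a \<noteq> 0" if "a \<in> {-1..1}" for a
    using denominator_pos[of a] that by (auto simp: abs_le_iff)
  have "continuous_on {-1..1} (\<lambda>a. unhom a (f a) $ i)" for i
    using exhaust_2[of i]
  proof
    assume i: "i = 1"
    show ?thesis unfolding unhom_def i vector_2 by (intro continuous_intros) (use d in auto)
  next
    assume i: "i = 2"
    show ?thesis unfolding unhom_def i vector_2 by (intro continuous_intros assms) (use d in auto)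
  qed
  then have "continuous_on {-1..1} (\<lambda>a. \<chi> i. unhom a (f a) $ i)"
    by (intro continuous_on_vec_lambda)
  then show ?thesis by simp
qed

lemma closure_field_interval: "closure ({-1<..<1} \<inter> F) = {-1..1}"
proof -
  have "closure F = UNIV"
    using closure_mono[OF Rats_subset] Rats_closure_real by auto
  then have "closure ({-1<..<1} \<inter> F) = closure {-1<..<1}"
    by (intro closure_open_Int_superset) auto
  then show ?thesis by simp
qed

text \<open>In the coordinates \<open>a\<close>, \<open>b\<close> each closed half of the circle is
  a graph over the interval from -1 to 1. Parameters in \<open>F\<close> are dense there and give
  points of \<open>F_circle\<close>, and continuity carries density over to the half circle.\<close>

lemma sphere_subset_closure: "sphere c \<rho> \<subseteq> closure F_circle"
proof
  fix p assume p: "p \<in> sphere c \<rho>"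
  define a b where "a = hom p $ 1 / hom p $ 3" and "b = hom p $ 2 / hom p $ 3"
  have circle: "a\<^sup>2 + b\<^sup>2 = 1"
    using p hom_3_pos[OF p] unfolding mem_sphere_iff
    by (simp add: a_def b_def power_divide add_divide_distrib[symmetric])
  then have "b\<^sup>2 = 1 - a\<^sup>2" by simp
  then have "\<bar>b\<bar> = sqrt (1 - a\<^sup>2)" by (metis real_sqrt_abs)
  \<comment> \<open>The sign \<open>\<sigma>\<close> selects a half circle containing
    \<open>p\<close>.\<close>
  then obtain \<sigma> :: real where \<sigma>: "\<sigma> = 1 \<or> \<sigma> = -1" "b = \<sigma> * sqrt (1 - a\<^sup>2)"
    by (metis abs_eq_iff' mult_1 mult_minus1)
  let ?g = "\<lambda>a. unhom a (\<sigma> * sqrt (1 - a\<^sup>2))"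
  have "continuous_on (closure ({-1<..<1} \<inter> F)) ?g"
    unfolding closure_field_interval by (intro continuous_on_unhom continuous_intros)
  moreover have "?g ` ({-1<..<1} \<inter> F) \<subseteq> F_circle"
    using \<sigma>(1) by (auto intro!: unhom_mem_F_circle)
  ultimately have "?g ` {-1..1} \<subseteq> closure F_circle"
    using image_closure_subset[of "{-1<..<1} \<inter> F" ?g "closure F_circle"] closure_subset
    unfolding closure_field_interval by blast
  moreover have "a\<^sup>2 \<le> 1" using circle by (metis le_add_same_cancel1 zero_le_power2)
  then have "a \<in> {-1..1}" by (auto simp: abs_square_le_1 abs_le_iff)
  moreover have "p = ?g a" using unhom_hom[OF p] \<sigma>(2) by (simp add: a_def b_def)
  ultimately show "p \<in> closure F_circle" by blast
qed

lemma dense_F_circle: "dense_in_circle F_circle (sphere c \<rho>)"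
  unfolding dense_in_circle_def
proof (intro conjI allI impI)
  show "F_circle \<subseteq> sphere c \<rho>" by (auto simp: F_circle_def)
next
  fix x r assume "0 < r \<and> ball x r \<inter> sphere c \<rho> \<noteq> {}"
  then have "ball x r \<inter> closure F_circle \<noteq> {}" using sphere_subset_closure by blast
  then show "F_circle \<inter> ball x r \<noteq> {}"
    using open_Int_closure_eq_empty[of "ball x r" F_circle] by auto
qed

text \<open>The factor \<open>\<mu>\<close> cancels in ratios of coordinates, so these ratios embed
  \<open>F_circle\<close> into the countable set \<open>F \<times> F\<close>.\<close>

lemma countable_F_circle:
  assumes "countable F"
  shows "countable F_circle"
proof -
  let ?f = "\<lambda>p. (hom p $ 1 / hom p $ 3, hom p $ 2 / hom p $ 3)"
  have "?f ` F_circle \<subseteq> F \<times> F"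
  proof (rule image_subsetI)
    fix p assume p: "p \<in> F_circle"
    then obtain z \<mu> where z: "z \<in> Fvec" "hom p = \<mu> *\<^sub>R z"
      by (auto simp: F_circle_def F_point_def)
    then have "\<mu> \<noteq> 0" using hom_nonzero[of p] by auto
    then have "?f p = (z $ 1 / z $ 3, z $ 2 / z $ 3)" by (simp add: z)
    then show "?f p \<in> F \<times> F" using z(1) by (simp add: Fvec_def divide_mem)
  qed
  then have "countable (?f ` F_circle)"
    using assms by (meson countable_SIGMA countable_subset)
  moreover have "inj_on ?f F_circle"
    by (rule inj_on_inverseI[where g = "\<lambda>(a, b). unhom a b"])
      (simp add: F_circle_def unhom_hom)
  ultimately show ?thesis using countable_image_inj_eq by blast
qed

section \<open>Straightedge constructions\<close>

text \<open>The invariant of straightedge constructions: the given circle is the only curve allowed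
  besides lines over \<open>F\<close>.\<close>

definition F_letter :: "letter \<Rightarrow> bool" where
  "F_letter a \<longleftrightarrow> (case a of Point p \<Rightarrow> F_point p | Curve C \<Rightarrow> C = sphere c \<rho> \<or> F_line C)"

lemma F_letter_line_rule:
  assumes "\<forall>a\<in>letters u. F_letter a" "line_rule u a"
  shows "F_letter a"
proof -
  obtain p q where pq: "Point p \<in> letters u" "Point q \<in> letters u" "p \<noteq> q"
    "a = Curve (line_through p q)"
    using assms(2) line_rule_def by auto
  then have "F_point p" "F_point q" using assms(1) by (force simp: F_letter_def)+
  then show ?thesis using pq F_line_line_through by (simp add: F_letter_def)
qed

text \<open>Of two distinct curves at most one is the given circle, so only line-line and
  line-circle intersections arise.\<close>

lemma F_letter_intersection_rule:
  assumes "\<forall>a\<in>letters u. F_letter a" "intersection_rule u a"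
  shows "F_letter a"
proof -
  obtain x C D where *: "Curve C \<in> letters u" "Curve D \<in> letters u" "C \<noteq> D" "x \<in> C" "x \<in> D"
    "a = Point x"
    using assms(2) intersection_rule_def by auto
  have "C = sphere c \<rho> \<or> F_line C" "D = sphere c \<rho> \<or> F_line D"
    using assms(1) * by (force simp: F_letter_def)+
  then have "F_point x"
    using * F_point_Int_lines[of C D x] F_point_Int_line_circle[of C x]
      F_point_Int_line_circle[of D x] by blast
  then show ?thesis by (simp add: F_letter_def *)
qed

end

section \<open>Propagation of the invariant along a construction\<close>

lemma EC_inf_edgeE:
  assumes "EC_inf r V E" "(u, w) \<in> E"
  obtains a where "w = append_letter u a" "line_rule u a \<or> circle_rule u a \<or> intersection_rule u a"
proof -
  have "u \<in> V" "w \<in> children E u"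
    using assms by (auto simp: EC_inf_def rooted_tree_def children_def)
  then show ?thesis using assms(1) that unfolding EC_inf_def leaf_def by fastforce
qed

lemma letters_append_letter: "letters (append_letter u a) = insert a (letters u)"
  by (auto simp: letters_def append_letter_def)

context boosted_circle
begin

lemma F_letter_straightedge_edge:
  assumes "EC_inf r V E" "straightedge r V E" "(u, w) \<in> E" "\<forall>a\<in>letters u. F_letter a"
  shows "\<forall>a\<in>letters w. F_letter a"
proof -
  obtain a where a: "w = append_letter u a"
    "line_rule u a \<or> circle_rule u a \<or> intersection_rule u a"
    using EC_inf_edgeE[OF assms(1,3)] .
  have "F_letter a" if "circle_rule u a"
  proof -
    obtain p q s where pqs: "Point p \<in> letters u" "Point q \<in> letters u" "Point s \<in> letters u"
      "a = compass p q s"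
      using \<open>circle_rule u a\<close> by (auto simp: circle_rule_def)
    \<comment> \<open>The only circle rule left is degenerate: it returns \<open>Point p\<close>,
      already a letter of \<open>u\<close>.\<close>
    with assms(2,3) a(1) have "q = s" unfolding straightedge_def by blast
    then show ?thesis using pqs assms(4) by (simp add: compass_def)
  qed
  then have "F_letter a"
    using a(2) F_letter_line_rule F_letter_intersection_rule assms(4) by blast
  then show ?thesis using assms(4) by (simp add: a(1) letters_append_letter)
qed

lemma F_letter_straightedge:
  assumes "EC_inf r V E" "straightedge r V E" "\<forall>a\<in>letters r. F_letter a" "u \<in> V"
  shows "\<forall>a\<in>letters u. F_letter a"
proof -
  obtain us where us: "finite_walk V E us" "hd us = r" "last us = u"
    using assms(1,4) unfolding EC_inf_def rooted_tree_def by blast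
  have "\<forall>a\<in>letters (us ! i). F_letter a" if "i < length us" for i
    using that
  proof (induction i)
    case 0
    then show ?case using us assms(3) by (simp add: hd_conv_nth)
  next
    case (Suc i)
    then have "(us ! i, us ! Suc i) \<in> E" using us(1) by (simp add: finite_walk_def)
    then show ?case using Suc F_letter_straightedge_edge[OF assms(1,2)] by simp
  qed
  moreover have "us \<noteq> []" using us(1) by (simp add: finite_walk_def)
  ultimately show ?thesis using us(3) by (metis diff_less last_conv_nth length_greater_0_conv zero_less_one)
qed

end

text \<open>Otherwise following children from the root yields an infinite walk. It is maximal because
  nothing precedes the root, the only vertex whose finite part is empty.\<close>

lemma ex_leaf_if_terminating:
  assumes EC: "EC_inf r V E" and "terminating V E"
  shows "\<exists>u. leaf V E u"
proof (rule ccontr)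
  assume no_leaf: "\<nexists>u. leaf V E u"
  have r: "r \<in> V" "snd r = []" and E: "E \<subseteq> V \<times> V"
    using EC by (auto simp: EC_inf_def rooted_tree_def)
  have "\<forall>u\<in>V. \<exists>w. (u, w) \<in> E"
    using no_leaf by (auto simp: leaf_def children_def)
  then obtain next_vertex where step: "\<And>u. u \<in> V \<Longrightarrow> (u, next_vertex u) \<in> E"
    by metis
  define f where "f i = (next_vertex ^^ i) r" for i
  have f_V: "f i \<in> V" for i
  proof (induction i)
    case (Suc i)
    then show ?case using step[of "f i"] E by (auto simp: f_def)
  qed (simp add: f_def r)
  then have walk: "is_walk V E (Inf_Walk f)"
    using step by (auto simp: infinite_walk_def f_def)
  have "branch V E (Inf_Walk f)"
    unfolding branch_def
  proof (intro conjI allI impI walk)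
    fix b assume b: "is_walk V E b \<and> subwalk (Inf_Walk f) b"
    then obtain g where g: "b = Inf_Walk g" by (cases b) auto
    with b obtain n where n: "\<And>i. f i = g (n + i)" by auto
    have "n = 0"
    proof (cases n)
      case (Suc m)
      then have "(g m, r) \<in> E"
        using b g n[of 0] by (auto simp: infinite_walk_def f_def)
      then obtain a where "r = append_letter (g m) a" using EC_inf_edgeE[OF EC] by metis
      then show ?thesis using r(2) by (simp add: append_letter_def)
    qed simp
    then show "b = Inf_Walk f" using g n by auto
  qed
  then show False using assms(2) unfolding terminating_def by blast
qed

theorem theorem3p3:
  fixes k :: "point set" and c :: point and \<rho> :: real
  assumes "\<rho> > 0" and "k = sphere c \<rho>"
  shows "\<exists>(Y :: point set) (p :: nat \<Rightarrow> point).
           countable Y \<and> Y = range p \<and> Y \<subseteq> k \<and> dense_in_circle Y k \<and>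
           (\<forall>V E. EC_inf (circle_points_word k p) V E \<and>
                  straightedge (circle_points_word k p) V E \<longrightarrow>
                  (\<forall>u\<in>V. Point c \<notin> letters u)) \<and>
           \<not> constructs straightedge {[Point c]} (circle_points_word k p)"
proof -
  obtain F where F: "countable F" "sqrt_closed_field F"
    using countable_sqrt_closed_field by blast
  have "uncountable {0<..<1::real}" by (simp add: uncountable_open_interval)
  then obtain v where v: "0 < v" "v < 1" "v \<notin> F"
    using F(1) countable_subset[of "{0<..<1}" F] by (auto simp: subset_iff)
  interpret boosted_circle F c \<rho> v
    using F(2) v assms(1) by (simp add: boosted_circle_def boosted_circle_axioms_def)
  define p where "p = from_nat_into F_circle"
  have dense: "dense_in_circle F_circle k"
    using dense_F_circle assms(2) by simp
  \<comment> \<open>Enumerating a countable set by all naturals requires it to be nonempty.\<close>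
  have "sphere c \<rho> \<noteq> {}" using assms(1) by simp
  then have "F_circle \<noteq> {}" using sphere_subset_closure by auto
  then have p: "range p = F_circle"
    using countable_F_circle[OF F(1)] by (simp add: p_def range_from_nat_into)
  have letter: "F_letter a" if "a \<in> letters (circle_points_word k p)" for a
  proof -
    have "a = Curve k \<or> a \<in> Point ` range p"
      using that by (auto simp: letters_def circle_points_word_def split: nat.splits)
    then show ?thesis using assms(2) by (auto simp: F_letter_def p F_circle_def)
  qed
  have avoid: "Point c \<notin> letters u"
    if "EC_inf (circle_points_word k p) V E" "straightedge (circle_points_word k p) V E" "u \<in> V"
    for V E u
    using F_letter_straightedge[OF that(1,2) _ that(3)] letter not_F_point_center[OF v(3)]
    by (force simp: F_letter_def)
  \<comment> \<open>The condition on leaves would hold vacuously in a tree without leaves, so a leaf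
    must first be found from termination.\<close>
  have "\<not> constructs straightedge {[Point c]} (circle_points_word k p)"
  proof
    assume "constructs straightedge {[Point c]} (circle_points_word k p)"
    then obtain V E where VE: "EC_inf (circle_points_word k p) V E"
      "straightedge (circle_points_word k p) V E" "terminating V E"
      "\<And>u. leaf V E u \<Longrightarrow> final_segment [Point c] u"
      unfolding constructs_def by auto
    obtain u where u: "leaf V E u" using ex_leaf_if_terminating[OF VE(1,3)] by blast
    then have "Point c \<in> letters u"
      using VE(4)[OF u] by (auto simp: final_segment_def letters_def suffix_def)
    then show False using avoid[OF VE(1,2)] u by (simp add: leaf_def)
  qed
  moreover have "F_circle \<subseteq> k" using dense by (simp add: dense_in_circle_def)
  ultimately show ?thesis
    using countable_F_circle[OF F(1)] p dense avoid by (intro exI[of _ F_circle] exI[of _ p]) blast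
qed

end
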